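(* Every $4$-dimensional Acaa-algebra over a field $\mathbb K$ of characteristic $0$ is isomorphic to one of the following: (1) the $4$-dimensional abelian algebra; (2) the $4$-dimensional $2$-step nilpotent Lie algebra $\mathcal H_3\oplus\mathbb K$, given in a basis $\{e_1,e_2,e_3,e_4\}$ by $[e_1,e_2]=e_3$ and all other brackets of basis vectors (not determined by anticommutativity) zero.
   Context: An Acaa-algebra over a field $\mathbb K$ of characteristic $0$ is a $\mathbb K$-vector space $A$ with a bilinear product $[\cdot,\cdot]$ which is anticommutative, $[x,y]=-[y,x]$, and satisfies $[x_1,[x_2,x_3]]=[x_2,[x_3,x_1]]$ for all $x_1,x_2,x_3\in A$. Isomorphism means a linear bijection preserving the bracket. *)

theory Defs
  imports "HOL-Analysis.Analysis" "HOL-Library.Numeral_Type"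
begin

text \<open>An algebra is given by a vector space structure (scalar multiplication s over a
field 'k on the additive group 'v) together with a bilinear bracket br.\<close>

definition bilinear_bracket :: "('k::field \<Rightarrow> 'v \<Rightarrow> 'v) \<Rightarrow> ('v::ab_group_add \<Rightarrow> 'v \<Rightarrow> 'v) \<Rightarrow> bool" where
  "bilinear_bracket s br \<longleftrightarrow>
     (\<forall>x. Vector_Spaces.linear s s (br x)) \<and> (\<forall>y. Vector_Spaces.linear s s (\<lambda>x. br x y))"

definition acaa_algebra :: "('k::field \<Rightarrow> 'v \<Rightarrow> 'v) \<Rightarrow> ('v::ab_group_add \<Rightarrow> 'v \<Rightarrow> 'v) \<Rightarrow> bool" where
  "acaa_algebra s br \<longleftrightarrow> vector_space s \<and> bilinear_bracket s br \<and>
     (\<forall>x y. br x y = - br y x) \<and>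
     (\<forall>x1 x2 x3. br x1 (br x2 x3) = br x2 (br x3 x1))"

definition algebra_iso ::
  "('k::field \<Rightarrow> 'v \<Rightarrow> 'v) \<Rightarrow> ('v::ab_group_add \<Rightarrow> 'v \<Rightarrow> 'v) \<Rightarrow>
   ('k \<Rightarrow> 'w \<Rightarrow> 'w) \<Rightarrow> ('w::ab_group_add \<Rightarrow> 'w \<Rightarrow> 'w) \<Rightarrow> ('v \<Rightarrow> 'w) \<Rightarrow> bool" where
  "algebra_iso s1 br1 s2 br2 f \<longleftrightarrow> Vector_Spaces.linear s1 s2 f \<and> bij f \<and>
     (\<forall>x y. f (br1 x y) = br2 (f x) (f y))"

definition algebras_isomorphic ::
  "('k::field \<Rightarrow> 'v \<Rightarrow> 'v) \<Rightarrow> ('v::ab_group_add \<Rightarrow> 'v \<Rightarrow> 'v) \<Rightarrow>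
   ('k \<Rightarrow> 'w \<Rightarrow> 'w) \<Rightarrow> ('w::ab_group_add \<Rightarrow> 'w \<Rightarrow> 'w) \<Rightarrow> bool" where
  "algebras_isomorphic s1 br1 s2 br2 \<longleftrightarrow> (\<exists>f. algebra_iso s1 br1 s2 br2 f)"

text \<open>Model algebras on 'k^4 with standard basis e_i = axis i 1 (indices 1,2,3,4).\<close>

definition abelian4 :: "'k::field ^ 4 \<Rightarrow> 'k ^ 4 \<Rightarrow> 'k ^ 4" where
  "abelian4 x y = 0"

text \<open>H_3 + K: [e1,e2] = e3 = -[e2,e1], all other brackets of basis vectors zero.\<close>
definition heis3_plus_K :: "'k::field ^ 4 \<Rightarrow> 'k ^ 4 \<Rightarrow> 'k ^ 4" where
  "heis3_plus_K x y = (\<chi> i. if i = 3 then x$1 * y$2 - x$2 * y$1 else 0)"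

end

theory Submission
  imports Defs
begin

text \<open>The triple product br a (br b c) of an Acaa-algebra is alternating, and this forces
  every product of four elements to vanish. If br a (br b c) were nonzero, then
  br a (br b c), br b c, c, b, a would be linearly independent, which is impossible in
  dimension 4; so the algebra is 2-step nilpotent. If it is not abelian, choose x, y with
  z = br x y \<noteq> 0: then x, y, z are independent and a fourth basis vector u can be chosen to
  commute with x and y, which yields the multiplication table of H_3 + K.\<close>

lemma (in vector_space) independent_insert_card:
  assumes "x \<notin> span S" "independent S" "finite S"
  shows "independent (insert x S) \<and> card (insert x S) = Suc (card S)"
  using assms independent_insertI span_base by (auto simp: card_insert_if)

lemma (in vector_space) obtain_basis_family:
  assumes "dim UNIV = CARD('n::finite)"
  obtains b :: "'n::finite \<Rightarrow> 'b" where "independent (range b)" "span (range b) = UNIV"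
proof -
  obtain B where B: "independent B" "UNIV \<subseteq> span B" "card B = CARD('n)"
    using basis_exists[of UNIV] assms by auto
  then have "finite B"
    using card.infinite by force
  then obtain b :: "'n \<Rightarrow> 'b" where "bij_betw b UNIV B"
    using finite_same_card_bij[of "UNIV :: 'n set" B] B(3) by auto
  then have "range b = B"
    by (rule bij_betw_imp_surj_on)
  then show ?thesis
    using that B by auto
qed

lemma algebra_iso_inv:
  assumes "vector_space s1" "vector_space s2" "algebra_iso s1 br1 s2 br2 f"
  shows "algebra_iso s2 br2 s1 br1 (inv f)"
proof -
  have f: "Vector_Spaces.linear s1 s2 f" "bij f" "\<And>x y. f (br1 x y) = br2 (f x) (f y)"
    using assms(3) unfolding algebra_iso_def by auto
  interpret module_pair s1 s2
    by (simp add: module_pair_def module_iff_vector_space assms(1,2))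
  have "module_hom s2 s1 (inv f)"
    using f(1,2) by (intro bij_module_hom_imp_inv_module_hom) (simp_all add: module_hom_iff_linear)
  then have "Vector_Spaces.linear s2 s1 (inv f)"
    by (simp add: module_hom_iff_linear)
  moreover have "inv f (br2 x y) = br1 (inv f x) (inv f y)" for x y
    using f(3)[of "inv f x" "inv f y"] f(2) by (metis bij_inv_eq_iff surj_f_inv_f bij_is_surj)
  ultimately show ?thesis
    unfolding algebra_iso_def using f(2) bij_imp_bij_inv by blast
qed

definition lincomb ::
  "('k::field \<Rightarrow> 'v::ab_group_add \<Rightarrow> 'v) \<Rightarrow> ('n::finite \<Rightarrow> 'v) \<Rightarrow> 'k^'n \<Rightarrow> 'v" where
  "lincomb s b v = (\<Sum>i\<in>UNIV. s (v $ i) (b i))"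

lemma linear_lincomb:
  assumes "vector_space s"
  shows "Vector_Spaces.linear (*s) s (lincomb s b)"
proof -
  interpret vector_space s by fact
  show ?thesis
    unfolding Vector_Spaces.linear_iff
    by (simp add: vec.vector_space_axioms vector_space_axioms lincomb_def scale_left_distrib
        sum.distrib scale_sum_right)
qed

lemma lincomb_axis:
  assumes "vector_space s"
  shows "lincomb s b (axis i 1) = b i"
proof -
  interpret vector_space s by fact
  show ?thesis
    by (simp add: lincomb_def axis_def if_distrib[of "\<lambda>c. s c _"] cong: if_cong)
qed

lemma surj_lincomb:
  assumes "vector_space s" "module.span s (range b) = UNIV"
  shows "surj (lincomb s b)"
proof -
  interpret vector_space s by fact
  interpret L: Vector_Spaces.linear "(*s)" s "lincomb s b"
    by (rule linear_lincomb) fact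
  have "range b \<subseteq> range (lincomb s b)"
    by (metis assms(1) image_subsetI lincomb_axis rangeI)
  then have "span (range b) \<subseteq> range (lincomb s b)"
    by (rule span_minimal) (rule L.subspace_image[OF vec.subspace_UNIV])
  then show ?thesis
    using assms by auto
qed

lemma algebras_isomorphic_if_surj_hom:
  fixes s :: "'k::field \<Rightarrow> 'v::ab_group_add \<Rightarrow> 'v" and g :: "'k^'n \<Rightarrow> 'v"
  assumes vs: "vector_space s" and dim: "vector_space.dim s UNIV = CARD('n)"
    and g: "Vector_Spaces.linear (*s) s g" "surj g"
    and hom: "\<And>a c. g (M a c) = br (g a) (g c)"
  shows "algebras_isomorphic s br (*s) M"
proof -
  interpret vector_space s by fact
  obtain b :: "'n \<Rightarrow> 'v" where b: "independent (range b)" "span (range b) = UNIV"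
    using obtain_basis_family dim by blast
  interpret finite_dimensional_vector_space s "range b"
    using b by unfold_locales simp_all
  interpret finite_dimensional_vector_space_pair "(*s)" cart_basis s "range b" ..
  have "inj g"
    by (rule linear_surjective_imp_injective[OF g]) (metis dim vec_dim_card)
  then have "algebra_iso (*s) M s br g"
    unfolding algebra_iso_def using g hom bij_betw_def by blast
  then have "algebra_iso s br (*s) M (inv g)"
    by (rule algebra_iso_inv[OF vec.vector_space_axioms vs])
  then show ?thesis
    unfolding algebras_isomorphic_def by blast
qed

lemma algebras_isomorphic_zero_bracket:
  fixes s :: "'k::field \<Rightarrow> 'v::ab_group_add \<Rightarrow> 'v"
  assumes vs: "vector_space s" and dim: "vector_space.dim s UNIV = CARD('n::finite)"
    and zero: "\<And>x y. br x y = 0"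
  shows "algebras_isomorphic s br ((*s) :: 'k \<Rightarrow> 'k^'n \<Rightarrow> 'k^'n) (\<lambda>_ _. 0)"
proof -
  interpret vector_space s by fact
  obtain b :: "'n \<Rightarrow> 'v" where "span (range b) = UNIV"
    using obtain_basis_family dim by blast
  moreover have "lincomb s b 0 = 0"
    by (simp add: lincomb_def)
  ultimately show ?thesis
    using algebras_isomorphic_if_surj_hom[OF vs dim linear_lincomb[OF vs] surj_lincomb[OF vs]]
    by (simp add: zero)
qed

locale acaa =
  fixes s :: "'k::field_char_0 \<Rightarrow> 'v::ab_group_add \<Rightarrow> 'v"
    and br :: "'v \<Rightarrow> 'v \<Rightarrow> 'v"
  assumes acaa: "acaa_algebra s br"
begin

sublocale vector_space s
  using acaa unfolding acaa_algebra_def by blast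

interpretation endo: vector_space_pair s s ..

lemma linear_br_right: "Vector_Spaces.linear s s (br x)"
  using acaa unfolding acaa_algebra_def bilinear_bracket_def by blast

lemma linear_br_left: "Vector_Spaces.linear s s (\<lambda>x. br x y)"
  using acaa unfolding acaa_algebra_def bilinear_bracket_def by blast

lemma br_add_right: "br x (y + z) = br x y + br x z"
  and br_scale_right: "br x (s c y) = s c (br x y)"
  and br_neg_right: "br x (- y) = - br x y"
  and br_diff_right: "br x (y - z) = br x y - br x z"
  and br_zero_right: "br x 0 = 0"
  using linear_br_right[of x]
  by (simp_all add: endo.linear_add endo.linear_scale endo.linear_neg endo.linear_diff
      endo.linear_0)

lemma br_add_left: "br (x + y) z = br x z + br y z"
  and br_scale_left: "br (s c x) z = s c (br x z)"
  and br_neg_left: "br (- x) z = - br x z"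
  and br_diff_left: "br (x - y) z = br x z - br y z"
  and br_zero_left: "br 0 z = 0"
  by (simp_all add: endo.linear_add[OF linear_br_left] endo.linear_scale[OF linear_br_left]
      endo.linear_neg[OF linear_br_left] endo.linear_diff[OF linear_br_left]
      endo.linear_0[OF linear_br_left])

lemmas br_bilinear = br_add_right br_scale_right br_neg_right br_diff_right br_zero_right
  br_add_left br_scale_left br_neg_left br_diff_left br_zero_left

lemma br_anticomm: "br x y = - br y x"
  using acaa unfolding acaa_algebra_def by blast

lemma br_cyclic: "br x (br y z) = br y (br z x)"
  using acaa unfolding acaa_algebra_def by blast

lemma zero_if_eq_neg: "(x::'v) = - x \<Longrightarrow> x = 0"
  using scale_left_distrib[of 1 1 x] by (simp add: eq_neg_iff_add_eq_0)

lemma br_self [simp]: "br x x = 0"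
  using br_anticomm[of x x] by (rule zero_if_eq_neg)

lemma br_swap_left: "br x (br y z) = - br y (br x z)"
  using br_cyclic[of y x z] br_anticomm[of z y] by (simp add: br_neg_right)

lemma br_br_self [simp]: "br x (br x y) = 0"
  using br_swap_left[of x x y] by (rule zero_if_eq_neg)

lemma br_br_self' [simp]: "br x (br y x) = 0"
  using br_anticomm[of y x] by (simp add: br_neg_right)

text \<open>The quadrilinear map F x y u v = br x (br y (br u v)) changes sign under the
  transpositions of neighbouring arguments, hence is alternating; the even permutation
  (x y u v) to (u v x y) also changes its sign, so F vanishes.\<close>

lemma br_br_br [simp]: "br x (br y (br u v)) = 0"
proof -
  let ?F = "\<lambda>x y u v. br x (br y (br u v))"
  have swap_outer: "?F x y u v = br (br u v) (br x y)" for x y u v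
    using br_cyclic[of x y "br u v"] br_cyclic[of y "br u v" x] by simp
  have swap12: "?F x y u v = - ?F y x u v" for x y u v
    by (rule br_swap_left)
  have swap23: "?F x y u v = - ?F x u y v" for x y u v
    using br_swap_left[of y u v] by (simp add: br_neg_right)
  have swap34: "?F x y u v = - ?F x y v u" for x y u v
    using br_anticomm[of u v] by (simp add: br_neg_right)
  have "?F x y u v = ?F u v x y"
    using swap23[of x y u v] swap12[of x u y v] swap34[of u x y v] swap23[of u x v y] by simp
  moreover have "?F x y u v = - ?F u v x y"
    unfolding swap_outer using br_anticomm[of "br u v" "br x y"] .
  ultimately show ?thesis
    using zero_if_eq_neg by simp
qed

lemma br_br_left_self [simp]: "br (br x y) x = 0" "br (br x y) y = 0"
  using br_anticomm[of "br x y" x] br_anticomm[of "br x y" y] by simp_all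

lemma br_of_brs [simp]: "br (br u v) (br x y) = 0"
  using br_cyclic[of x y "br u v"] br_cyclic[of y "br u v" x] by simp

lemma not_in_span_if_br_vanishes:
  assumes "\<And>v. v \<in> S \<Longrightarrow> br a v = 0" and "br a y \<noteq> 0"
  shows "y \<notin> span S"
proof
  assume "y \<in> span S"
  then have "br a y = 0"
    using endo.linear_eq_0_on_span[OF linear_br_right] assms(1) by blast
  with assms(2) show False ..
qed

lemma independent_br_triple:
  assumes "br x y \<noteq> 0"
  shows "independent {x, y, br x y} \<and> card {x, y, br x y} = 3"
proof -
  have "br x y \<notin> span {}"
    using assms by simp
  moreover have "y \<notin> span {br x y}"
    by (rule not_in_span_if_br_vanishes[where a = x]) (auto simp: assms)
  moreover have "x \<notin> span {y, br x y}"
    by (rule not_in_span_if_br_vanishes[where a = y]) (auto simp: assms br_anticomm[of y x])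
  ultimately show ?thesis
    using independent_insert_card[of "br x y" "{}"] independent_insert_card[of y "{br x y}"]
      independent_insert_card[of x "{y, br x y}"]
    by simp
qed

text \<open>Each vector of the sequence br a (br b c), br b c, c, b, a lies outside the span of its
  predecessors: left multiplication by a, br a b, br c a resp. br b c kills the predecessors
  but not the vector itself.\<close>

lemma independent_of_triple_product_ne_0:
  assumes w: "br a (br b c) \<noteq> 0"
  shows "independent {a, b, c, br b c, br a (br b c)}
    \<and> card {a, b, c, br b c, br a (br b c)} = 5"
proof -
  have cyc1: "br b (br c a) = br a (br b c)" and cyc2: "br c (br a b) = br a (br b c)"
    using br_cyclic[of a b c] br_cyclic[of b c a] by simp_all
  have "br a (br b c) \<notin> span {}"
    using w by simp
  moreover have "br b c \<notin> span {br a (br b c)}"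
    by (rule not_in_span_if_br_vanishes[where a = a]) (auto simp: w)
  moreover have "c \<notin> span {br b c, br a (br b c)}"
    by (rule not_in_span_if_br_vanishes[where a = "br a b"])
      (auto simp: w br_anticomm[of "br a b" c] cyc2)
  moreover have "b \<notin> span {c, br b c, br a (br b c)}"
    by (rule not_in_span_if_br_vanishes[where a = "br c a"])
      (auto simp: w br_anticomm[of "br c a" b] cyc1)
  moreover have "a \<notin> span {b, c, br b c, br a (br b c)}"
    by (rule not_in_span_if_br_vanishes[where a = "br b c"])
      (auto simp: w br_anticomm[of "br b c" a])
  ultimately show ?thesis
    using independent_insert_card[of "br a (br b c)" "{}"]
      independent_insert_card[of "br b c" "{br a (br b c)}"]
      independent_insert_card[of c "{br b c, br a (br b c)}"]
      independent_insert_card[of b "{c, br b c, br a (br b c)}"]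
      independent_insert_card[of a "{b, c, br b c, br a (br b c)}"]
    by simp
qed

lemma multiple_of_br_if_commuting:
  assumes nil: "\<And>a b c. br a (br b c) = 0" and z: "br x y \<noteq> 0"
    and w: "w \<in> span {x, y, br x y}" "br x w = 0" "br y w = 0"
  obtains c where "w = s c (br x y)"
proof -
  obtain k1 where "w - s k1 x \<in> span {y, br x y}"
    using w(1) span_breakdown_eq by blast
  then obtain k2 where "w - s k1 x - s k2 y \<in> span {br x y}"
    using span_breakdown_eq by blast
  then obtain k3 where "w - s k1 x - s k2 y = s k3 (br x y)"
    by (auto simp: span_singleton)
  then have w_eq: "w = s k1 x + s k2 y + s k3 (br x y)"
    by (simp add: algebra_simps)
  have "s k2 (br x y) = 0"
    using w(2) by (simp add: w_eq br_bilinear nil)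
  moreover have "s k1 (br x y) = 0"
    using w(3) by (simp add: w_eq br_bilinear nil br_anticomm[of y x])
  ultimately show ?thesis
    using that[of k3] z by (simp add: w_eq)
qed

text \<open>In a 2-step nilpotent algebra br x u0 and br y u0 commute with x and y. If one of them
  lies outside span {x, y, br x y} it is the required u; otherwise both are multiples
  c (br x y) and c' (br x y), and u0 + c' x - c y commutes with x and y.\<close>

lemma exists_centralizing_complement:
  assumes nil: "\<And>a b c. br a (br b c) = 0" and z: "br x y \<noteq> 0"
    and u0: "u0 \<notin> span {x, y, br x y}"
  obtains u where "u \<notin> span {x, y, br x y}" "br x u = 0" "br y u = 0"
proof (cases "br x u0 \<in> span {x, y, br x y}")
  case False
  then show ?thesis
    using that[of "br x u0"] nil by blast
next
  case True
  then obtain c where c: "br x u0 = s c (br x y)"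
    using multiple_of_br_if_commuting nil z by blast
  show ?thesis
  proof (cases "br y u0 \<in> span {x, y, br x y}")
    case False
    then show ?thesis
      using that[of "br y u0"] nil by blast
  next
    case True
    then obtain c' where c': "br y u0 = s c' (br x y)"
      using multiple_of_br_if_commuting nil z by blast
    define u where "u = u0 + s c' x - s c y"
    have "u0 = u - s c' x + s c y"
      by (simp add: u_def)
    then have "u \<notin> span {x, y, br x y}"
      using u0 by (metis insert_iff span_add span_base span_diff span_scale)
    moreover have "br x u = 0" "br y u = 0"
      by (simp_all add: u_def br_bilinear c c' br_anticomm[of y x])
    ultimately show ?thesis
      using that by blast
  qed
qed

end

locale acaa4 = acaa s br for s :: "'k::field_char_0 \<Rightarrow> 'v::ab_group_add \<Rightarrow> 'v" and br +
  assumes dim_eq_4: "dim UNIV = 4"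
begin

lemma independent_bound_4:
  assumes "independent S"
  shows "finite S \<and> card S \<le> 4"
proof -
  obtain b :: "4 \<Rightarrow> 'v" where "span (range b) = UNIV"
    using obtain_basis_family[where 'n = 4] dim_eq_4 by auto
  then have "finite S \<and> card S \<le> card (range b)"
    using independent_span_bound[of "range b" S] assms by simp
  then show ?thesis
    using card_image_le[of "UNIV :: 4 set" b] by simp
qed

lemma span_eq_UNIV_if_independent_card_4:
  assumes "independent S" "card S = 4"
  shows "span S = UNIV"
proof (rule ccontr)
  assume "span S \<noteq> UNIV"
  then obtain v where "v \<notin> span S"
    by auto
  moreover have "finite S"
    using assms(2) card.infinite by force
  ultimately have "independent (insert v S) \<and> card (insert v S) = 5"
    using independent_insert_card[of v S] assms by simp
  then show False
    using independent_bound_4[of "insert v S"] by simp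
qed

lemma exists_not_in_span:
  assumes "finite S" "card S < 4"
  obtains v where "v \<notin> span S"
  using dim_le_card[of UNIV S] assms dim_eq_4 by auto

lemma triple_product_eq_0 [simp]: "br a (br b c) = 0"
proof (rule ccontr)
  assume "br a (br b c) \<noteq> 0"
  then have "independent {a, b, c, br b c, br a (br b c)}"
    and "card {a, b, c, br b c, br a (br b c)} = 5"
    using independent_of_triple_product_ne_0 by auto
  then show False
    using independent_bound_4 by fastforce
qed

lemma triple_product_eq_0' [simp]: "br (br a b) c = 0"
  using br_anticomm[of "br a b" c] by simp

lemma algebras_isomorphic_heis3_plus_K:
  assumes xy: "br x y \<noteq> 0"
  shows "algebras_isomorphic s br ((*s) :: 'k \<Rightarrow> 'k^4 \<Rightarrow> 'k^4) heis3_plus_K"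
proof -
  have xyz: "independent {x, y, br x y} \<and> card {x, y, br x y} = 3"
    using independent_br_triple[OF xy] .
  then obtain u0 where "u0 \<notin> span {x, y, br x y}"
    using exists_not_in_span[of "{x, y, br x y}"] by auto
  then obtain u where u: "u \<notin> span {x, y, br x y}" "br x u = 0" "br y u = 0"
    using exists_centralizing_complement[OF triple_product_eq_0 xy] by blast
  define b :: "4 \<Rightarrow> 'v"
    where "b i = (if i = 1 then x else if i = 2 then y else if i = 3 then br x y else u)" for i
  have b: "b 1 = x" "b 2 = y" "b 3 = br x y" "b 4 = u"
    by (simp_all add: b_def)
  have "range b = insert u {x, y, br x y}"
    using b by (auto simp: UNIV_4)
  then have "span (range b) = UNIV"
    using span_eq_UNIV_if_independent_card_4 independent_insert_card[OF u(1)] xyz by simp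
  moreover have "lincomb s b (heis3_plus_K v w) = br (lincomb s b v) (lincomb s b w)" for v w
    by (simp add: lincomb_def sum_4 b heis3_plus_K_def br_bilinear u br_anticomm[of y x]
        br_anticomm[of u x] br_anticomm[of u y] scale_scale scale_left_diff_distrib mult.commute)
  ultimately show ?thesis
    using algebras_isomorphic_if_surj_hom[where 'n = 4, OF vector_space_axioms _
        linear_lincomb[OF vector_space_axioms] surj_lincomb[OF vector_space_axioms]]
      dim_eq_4 by simp
qed

end

theorem mainTheorem4:
  fixes s :: "'k::field_char_0 \<Rightarrow> 'v::ab_group_add \<Rightarrow> 'v"
    and br :: "'v \<Rightarrow> 'v \<Rightarrow> 'v"
  assumes "acaa_algebra s br"
    and "vector_space.dim s (UNIV :: 'v set) = 4"
  shows "algebras_isomorphic s br ((*s) :: 'k \<Rightarrow> 'k^4 \<Rightarrow> 'k^4) abelian4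
       \<or> algebras_isomorphic s br ((*s) :: 'k \<Rightarrow> 'k^4 \<Rightarrow> 'k^4) heis3_plus_K"
proof -
  interpret acaa4 s br
    by (intro acaa4.intro acaa.intro acaa4_axioms.intro assms)
  show ?thesis
  proof (cases "\<forall>x y. br x y = 0")
    case True
    then show ?thesis
      using algebras_isomorphic_zero_bracket[where 'n = 4, OF vector_space_axioms, of br]
      by (simp add: dim_eq_4 abelian4_def[abs_def])
  next
    case False
    then show ?thesis
      using algebras_isomorphic_heis3_plus_K by blast
  qed
qed

end
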